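(* Fix positive integers $a$ and $b$. For every $\varepsilon>0$ there exists $n_0$ such that for all $n\ge n_0$, every subset $A\subseteq\{1,\dots,n\}$ with no nontrivial solution $(x_1,\dots,x_5)\in A^5$ to the equation $a x_1+a x_2+b x_3=a x_4+(a+b)x_5$ satisfies $|A|\le\varepsilon\sqrt n$. Here a solution is trivial if it is of the form $(x_1,\dots,x_5)=(x,y,y,x,y)$ or $(y,x,y,x,y)$, or (only when $a=b$) $(y,y,x,x,y)$, for some $x,y\in\mathbb Z$.
   Context: Equivalently, such a set has size $o(\sqrt n)$. *)

theory Defs
  imports Complex_Main
begin

definition trivial_sol :: "nat \<Rightarrow> nat \<Rightarrow> int \<Rightarrow> int \<Rightarrow> int \<Rightarrow> int \<Rightarrow> int \<Rightarrow> bool" where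
  "trivial_sol a b x1 x2 x3 x4 x5 \<longleftrightarrow>
     (\<exists>x y :: int.
        (x1, x2, x3, x4, x5) = (x, y, y, x, y) \<or>
        (x1, x2, x3, x4, x5) = (y, x, y, x, y) \<or>
        (a = b \<and> (x1, x2, x3, x4, x5) = (y, y, x, x, y)))"

definition is_solution :: "nat \<Rightarrow> nat \<Rightarrow> int \<Rightarrow> int \<Rightarrow> int \<Rightarrow> int \<Rightarrow> int \<Rightarrow> bool" where
  "is_solution a b x1 x2 x3 x4 x5 \<longleftrightarrow>
     int a * x1 + int a * x2 + int b * x3 = int a * x4 + (int a + int b) * x5"

definition no_nontrivial_sol :: "nat \<Rightarrow> nat \<Rightarrow> nat set \<Rightarrow> bool" where
  "no_nontrivial_sol a b A \<longleftrightarrow>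
     (\<forall>x1\<in>A. \<forall>x2\<in>A. \<forall>x3\<in>A. \<forall>x4\<in>A. \<forall>x5\<in>A.
        is_solution a b (int x1) (int x2) (int x3) (int x4) (int x5) \<longrightarrow>
        trivial_sol a b (int x1) (int x2) (int x3) (int x4) (int x5))"

end

theory Submission
  imports Defs "HOL-Library.FuncSet"
begin

text \<open>
  Putting \<open>x3 = x5\<close> shows that \<open>A\<close> is a Sidon set. Embed it in the integers modulo
  \<open>N = 2 (a + b) n\<close>, suppose \<open>card A \<ge> \<delta> \<surd>N\<close>, and let \<open>spec \<eta>\<close> be the set of frequencies
  \<open>r\<close> at which the transform of \<open>A\<close> at \<open>a r\<close> is at least \<open>\<eta> \<surd>N\<close>. The Sidon property bounds
  the fourth moments of \<open>A\<close> and its subsets, hence the size of \<open>spec \<eta>\<close>, and it bounds the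
  square sum (energy) over \<open>spec \<eta>\<close> by \<open>4 N\<close>, uniformly in \<open>\<eta>\<close> once \<open>n\<close> is large.

  So along a rapidly decreasing sequence of thresholds two consecutive ones \<open>\<eta> > \<eta>'\<close> have
  almost the same energy. Take \<open>D\<close> to be a large part of \<open>A\<close> on which all characters in
  \<open>spec \<eta>\<close> are nearly constant, and count the solutions with \<open>x1, x4\<close> in \<open>A\<close> and
  \<open>x2, x3, x5\<close> in \<open>D\<close> by Fourier inversion. Frequencies in \<open>spec \<eta>\<close> contribute positively, since
  \<open>a x2 + b x3 - (a + b) x5\<close> is nearly annihilated by them; those between the thresholds
  contribute little since their energy is small; those below \<open>\<eta>'\<close> are controlled by the fourth
  moments. This gives order \<open>N powr (3/2)\<close> solutions, whereas there are only \<open>O(N)\<close> trivial ones.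
\<close>

section \<open>Additive characters modulo \<open>N\<close> and their orthogonality\<close>

definition echar :: "nat \<Rightarrow> int \<Rightarrow> complex" where
  "echar N k = cis (2 * pi * (of_int k / of_nat N))"

lemma echar_add: "echar N (j + k) = echar N j * echar N k"
  by (simp add: echar_def cis_mult add_divide_distrib ring_distribs)

lemma echar_diff: "echar N (j - k) = echar N j * cnj (echar N k)"
  by (simp add: echar_def cis_cnj cis_mult diff_divide_distrib ring_distribs)

lemma norm_echar [simp]: "norm (echar N k) = 1"
  by (simp add: echar_def)

lemma echar_0 [simp]: "echar N 0 = 1"
  by (simp add: echar_def)

lemma echar_power: "echar N (int r * k) = echar N k ^ r"
  by (simp add: echar_def DeMoivre mult_ac)

lemma echar_eq_1_iff:
  assumes "N > 0"
  shows "echar N k = 1 \<longleftrightarrow> int N dvd k"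
proof
  assume "echar N k = 1"
  then have "cos (2 * pi * (of_int k / of_nat N)) = 1"
    by (metis echar_def cis.sel(1) one_complex.sel(1))
  then obtain q :: int where "2 * pi * (of_int k / of_nat N) = of_int q * 2 * pi"
    unfolding cos_one_2pi_int by blast
  then have "real_of_int k = of_int q * of_nat N"
    using assms by (simp add: field_simps)
  then have "real_of_int k = real_of_int (q * int N)"
    by simp
  then have "k = q * int N"
    by (simp only: of_int_eq_iff)
  then show "int N dvd k"
    by simp
next
  assume "int N dvd k"
  then obtain q where q: "k = int N * q" ..
  have "2 * pi * (of_int k / of_nat N) = 2 * pi * real_of_int q"
    using assms by (simp add: q)
  then show "echar N k = 1"
    by (simp add: echar_def cis_multiple_2pi)
qed

lemma echar_orthogonality:
  assumes "N > 0"
  shows "(\<Sum>r<N. echar N (int r * k)) = (if int N dvd k then of_nat N else 0)"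
proof (cases "int N dvd k")
  case True
  then show ?thesis
    using assms by (simp add: echar_power echar_eq_1_iff[THEN iffD2])
next
  case False
  have "echar N k ^ N = 1"
    using assms by (simp add: echar_eq_1_iff flip: echar_power)
  with False assms show ?thesis
    by (simp add: echar_power geometric_sum echar_eq_1_iff)
qed

text \<open>Orthogonality as a counting device: after exchanging the sums, each index contributes
  \<open>N\<close> or nothing.\<close>

lemma sum_echar_eq_card:
  assumes "N > 0" "finite I"
  shows "(\<Sum>r<N. \<Sum>i\<in>I. echar N (int r * u i)) = of_nat (N * card {i\<in>I. int N dvd u i})"
proof -
  have "(\<Sum>r<N. \<Sum>i\<in>I. echar N (int r * u i)) = (\<Sum>i\<in>I. \<Sum>r<N. echar N (int r * u i))"
    by (rule sum.swap)
  also have "\<dots> = (\<Sum>i\<in>I. if int N dvd u i then of_nat N else 0)"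
    using assms by (simp add: echar_orthogonality)
  also have "\<dots> = (\<Sum>i\<in>{i\<in>I. int N dvd u i}. of_nat N)"
    using assms by (simp add: sum.If_cases Int_def)
  finally show ?thesis
    by (simp add: mult.commute)
qed

lemma norm_sum_echar_squared:
  "of_real ((norm (\<Sum>i\<in>I. echar N (k * u i)))\<^sup>2)
    = (\<Sum>(i, j)\<in>I \<times> I. echar N (k * (u i - u j)))"
proof -
  have "of_real ((norm (\<Sum>i\<in>I. echar N (k * u i)))\<^sup>2)
      = (\<Sum>i\<in>I. echar N (k * u i)) * (\<Sum>j\<in>I. cnj (echar N (k * u j)))"
    by (simp only: complex_norm_square cnj_sum)
  also have "\<dots> = (\<Sum>(i, j)\<in>I \<times> I. echar N (k * u i) * cnj (echar N (k * u j)))"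
    by (simp add: sum_product sum.cartesian_product)
  finally show ?thesis
    by (simp add: right_diff_distrib echar_diff)
qed

text \<open>Parseval in collision form: the squared modulus expands over pairs of indices, and
  averaging over \<open>r\<close> keeps the pairs on which \<open>u\<close> collides modulo
  \<open>N\<close>. The moment bounds below take \<open>I\<close> to be a product set.\<close>

lemma second_moment_echar:
  assumes "N > 0" "finite I"
  shows "(\<Sum>r<N. (norm (\<Sum>i\<in>I. echar N (int r * u i)))\<^sup>2)
    = real N * card {(i, j)\<in>I \<times> I. int N dvd u i - u j}"
proof -
  have "complex_of_real (\<Sum>r<N. (norm (\<Sum>i\<in>I. echar N (int r * u i)))\<^sup>2)
      = (\<Sum>r<N. \<Sum>p\<in>I \<times> I. echar N (int r * (u (fst p) - u (snd p))))"
    by (simp only: of_real_sum norm_sum_echar_squared) (simp add: case_prod_unfold)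
  also have "\<dots> = of_nat (N * card {p\<in>I \<times> I. int N dvd u (fst p) - u (snd p)})"
    using assms by (intro sum_echar_eq_card) auto
  also have "{p\<in>I \<times> I. int N dvd u (fst p) - u (snd p)} = {(i, j)\<in>I \<times> I. int N dvd u i - u j}"
    by auto
  finally have "complex_of_real (\<Sum>r<N. (norm (\<Sum>i\<in>I. echar N (int r * u i)))\<^sup>2)
      = complex_of_real (real N * card {(i, j)\<in>I \<times> I. int N dvd u i - u j})"
    by simp
  then show ?thesis
    by (simp only: of_real_eq_iff)
qed

section \<open>Fourier transforms and moment bounds for Sidon sets\<close>

definition fourier :: "nat \<Rightarrow> int set \<Rightarrow> int \<Rightarrow> complex" where
  "fourier N X k = (\<Sum>x\<in>X. echar N (k * x))"

lemma norm_fourier_le: "norm (fourier N X k) \<le> card X"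
  unfolding fourier_def using norm_sum[of "\<lambda>x. echar N (k * x)" X] by simp

lemma fourier_0 [simp]: "fourier N X 0 = of_nat (card X)"
  by (simp add: fourier_def)

definition sidon :: "int set \<Rightarrow> bool" where
  "sidon X \<longleftrightarrow> (\<forall>x\<in>X. \<forall>y\<in>X. \<forall>z\<in>X. \<forall>w\<in>X. x + y = z + w \<longrightarrow> (x = z \<and> y = w) \<or> (x = w \<and> y = z))"

lemma sidon_subset: "sidon X \<Longrightarrow> Y \<subseteq> X \<Longrightarrow> sidon Y"
  unfolding sidon_def by (meson subsetD)

text \<open>No wraparound: the hypotheses force \<open>\<bar>c * k\<bar> < N\<close>, and the only
  multiple of \<open>N\<close> in that range is 0.\<close>

lemma dvd_small_imp_eq_0:
  fixes c k :: int and n N :: nat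
  assumes "int N dvd c * k" "\<bar>k\<bar> < 2 * int n" "c > 0" "2 * c * int n \<le> int N"
  shows "k = 0"
proof (rule ccontr)
  assume "k \<noteq> 0"
  then have "int N \<le> \<bar>c * k\<bar>"
    using assms by (intro zdvd_imp_le) auto
  also have "\<dots> = c * \<bar>k\<bar>"
    using assms by (simp add: abs_mult)
  also have "\<dots> < c * (2 * int n)"
    using assms by simp
  finally show False
    using assms by (simp add: mult_ac)
qed

text \<open>The fourth power of the transform is the squared modulus of a sum over pairs, so the
  moment counts quadruples with \<open>c * (x + y)\<close> and \<open>c * (z + w)\<close> congruent
  modulo \<open>N\<close>. Without wraparound these satisfy \<open>x + y = z + w\<close>, and the
  Sidon property leaves only the identical and the swapped pairs.\<close>

lemma fourth_moment_sidon:
  fixes c :: int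
  assumes "sidon X" "X \<subseteq> {1..int n}" "c > 0" "2 * c * int n \<le> int N" "n > 0"
  shows "(\<Sum>r<N. norm (fourier N X (c * int r)) ^ 4) \<le> 2 * real N * (real (card X))\<^sup>2"
proof -
  have fin: "finite X"
    using assms finite_subset by blast
  have N: "N > 0"
    using assms by (smt (verit) mult_pos_pos of_nat_0_less_iff)
  define u where "u = (\<lambda>(x, y). c * (x + y))"
  define Q where "Q = {(i, j)\<in>(X \<times> X) \<times> (X \<times> X). int N dvd u i - u j}"
  have "norm (fourier N X (c * int r)) ^ 4 = (norm (\<Sum>i\<in>X \<times> X. echar N (int r * u i)))\<^sup>2" for r
  proof -
    have "(\<Sum>i\<in>X \<times> X. echar N (int r * u i)) = fourier N X (c * int r) * fourier N X (c * int r)"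
      unfolding fourier_def sum_product sum.cartesian_product
      by (intro sum.cong) (auto simp: u_def ring_distribs mult_ac simp flip: echar_add)
    then show ?thesis
      by (simp add: norm_mult power4_eq_xxxx power2_eq_square)
  qed
  then have "(\<Sum>r<N. norm (fourier N X (c * int r)) ^ 4) = real N * card Q"
    using second_moment_echar[OF N, of "X \<times> X" u] fin by (simp add: Q_def)
  also have "card Q \<le> 2 * (card X)\<^sup>2"
  proof -
    have "Q \<subseteq> (\<lambda>i. (i, i)) ` (X \<times> X) \<union> (\<lambda>(x, y). ((x, y), (y, x))) ` (X \<times> X)"
    proof
      fix q assume "q \<in> Q"
      then obtain x y z w where q: "q = ((x, y), (z, w))"
        and X: "x \<in> X" "y \<in> X" "z \<in> X" "w \<in> X" and dvd: "int N dvd c * (x + y - z - w)"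
        by (auto simp: Q_def u_def algebra_simps)
      have "1 \<le> x" "x \<le> int n" "1 \<le> y" "y \<le> int n" "1 \<le> z" "z \<le> int n" "1 \<le> w" "w \<le> int n"
        using X assms(2) by auto
      then have "\<bar>x + y - z - w\<bar> < 2 * int n"
        by linarith
      then have "x + y = z + w"
        using dvd_small_imp_eq_0[OF dvd] assms by fastforce
      then have "(x = z \<and> y = w) \<or> (x = w \<and> y = z)"
        using assms(1) X unfolding sidon_def by blast
      then show "q \<in> (\<lambda>i. (i, i)) ` (X \<times> X) \<union> (\<lambda>(x, y). ((x, y), (y, x))) ` (X \<times> X)"
        using q X by auto
    qed
    then have "card Q \<le> card ((\<lambda>i. (i, i)) ` (X \<times> X) \<union> (\<lambda>(x, y). ((x, y), (y, x))) ` (X \<times> X))"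
      using fin by (intro card_mono) auto
    also have "\<dots> \<le> card ((\<lambda>i. (i, i)) ` (X \<times> X)) + card ((\<lambda>(x, y). ((x, y), (y, x))) ` (X \<times> X))"
      by (rule card_Un_le)
    also have "\<dots> \<le> card (X \<times> X) + card (X \<times> X)"
      using fin by (intro add_mono card_image_le) auto
    finally show ?thesis
      by (simp add: card_cartesian_product power2_eq_square)
  qed
  then have "real N * card Q \<le> real N * real (2 * (card X)\<^sup>2)"
    by (intro mult_left_mono) (simp_all only: of_nat_le_iff of_nat_0_le_iff)
  finally show ?thesis
    by simp
qed

text \<open>The zero frequency alone contributes \<open>card X ^ 4\<close> to the fourth
  moment.\<close>

lemma sidon_card_squared_le:
  fixes c :: int
  assumes "sidon X" "X \<subseteq> {1..int n}" "c > 0" "2 * c * int n \<le> int N" "n > 0"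
  shows "(real (card X))\<^sup>2 \<le> 2 * real N"
proof (cases "card X = 0")
  case False
  have N: "N > 0"
    using assms by (smt (verit) mult_pos_pos of_nat_0_less_iff)
  have "real (card X) ^ 4 = norm (fourier N X (c * int 0)) ^ 4"
    by simp
  also have "\<dots> \<le> (\<Sum>r<N. norm (fourier N X (c * int r)) ^ 4)"
    using N by (intro member_le_sum) auto
  also have "\<dots> \<le> 2 * real N * (real (card X))\<^sup>2"
    by (rule fourth_moment_sidon[OF assms])
  finally have "(real (card X))\<^sup>2 * (real (card X))\<^sup>2 \<le> 2 * real N * (real (card X))\<^sup>2"
    by (simp add: power4_eq_xxxx power2_eq_square mult_ac)
  moreover have "(real (card X))\<^sup>2 > 0"
    using False by simp
  ultimately show ?thesis
    by (rule mult_right_le_imp_le)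
qed auto

text \<open>The moment counts collisions of \<open>c * x + t\<close> with \<open>c * y + s\<close>
  modulo \<open>N\<close>. If \<open>t = s\<close> then \<open>x = y\<close>, which leaves
  \<open>card X * card B\<close> choices; if \<open>t \<noteq> s\<close>, the Sidon property
  recovers \<open>(x, y)\<close> from \<open>(t, s)\<close>, which leaves at most
  \<open>card B\<close> squared.\<close>

lemma mixed_moment_sidon:
  fixes c :: int
  assumes "sidon X" "X \<subseteq> {1..int n}" "c > 0" "2 * c * int n \<le> int N" "n > 0" "B \<subseteq> {0..<int N}"
  shows "(\<Sum>r<N. (norm (fourier N X (c * int r)))\<^sup>2 * (norm (fourier N B (int r)))\<^sup>2)
    \<le> real N * (real (card X) * real (card B) + (real (card B))\<^sup>2)"
proof -
  have fin: "finite X" "finite B"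
    using assms finite_subset by blast+
  have N: "N > 0"
    using assms by (smt (verit) mult_pos_pos of_nat_0_less_iff)
  define u where "u = (\<lambda>(x, t). c * x + t)"
  define Q where "Q = {(i, j)\<in>(X \<times> B) \<times> (X \<times> B). int N dvd u i - u j}"
  have "(norm (fourier N X (c * int r)))\<^sup>2 * (norm (fourier N B (int r)))\<^sup>2
      = (norm (\<Sum>i\<in>X \<times> B. echar N (int r * u i)))\<^sup>2" for r
  proof -
    have "(\<Sum>i\<in>X \<times> B. echar N (int r * u i)) = fourier N X (c * int r) * fourier N B (int r)"
      unfolding fourier_def sum_product sum.cartesian_product
      by (intro sum.cong) (auto simp: u_def algebra_simps simp flip: echar_add)
    then show ?thesis
      by (simp add: norm_mult power_mult_distrib)
  qed
  then have "(\<Sum>r<N. (norm (fourier N X (c * int r)))\<^sup>2 * (norm (fourier N B (int r)))\<^sup>2) = real N * card Q"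
    using second_moment_echar[OF N, of "X \<times> B" u] fin by (simp add: Q_def)
  also have "card Q \<le> card X * card B + (card B)\<^sup>2"
  proof -
    have Q: "x \<in> X \<and> y \<in> X \<and> t \<in> B \<and> s \<in> B \<and> int N dvd c * (x - y) + (t - s)"
      if "((x, t), (y, s)) \<in> Q" for x y t s
      using that by (auto simp: Q_def u_def algebra_simps)
    have bd: "1 \<le> x \<and> x \<le> int n" if "x \<in> X" for x
      using that assms(2) by auto
    have diag: "x = y" if "((x, t), (y, t)) \<in> Q" for x y t
    proof -
      have "\<bar>x - y\<bar> < 2 * int n"
        using Q[OF that] bd[of x] bd[of y] by linarith
      then show ?thesis
        using Q[OF that] dvd_small_imp_eq_0[of N c "x - y" n] assms by simp
    qed
    have inj: "x = x' \<and> y = y'"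
      if q: "((x, t), (y, s)) \<in> Q" "((x', t), (y', s)) \<in> Q" and "t \<noteq> s" for x y x' y' t s
    proof -
      \<comment> \<open>Subtracting the two congruences removes \<open>t - s\<close>, leaving a
        relation among four elements of \<open>X\<close>.\<close>
      have "int N dvd (c * (x - y) + (t - s)) - (c * (x' - y') + (t - s))"
        using Q q by (blast intro: dvd_diff)
      then have "int N dvd c * (x - y - x' + y')"
        by (simp add: algebra_simps)
      moreover have "\<bar>x - y - x' + y'\<bar> < 2 * int n"
        using Q[OF q(1)] Q[OF q(2)] bd[of x] bd[of y] bd[of x'] bd[of y'] by linarith
      ultimately have "x + y' = x' + y"
        using dvd_small_imp_eq_0[of N c "x - y - x' + y'" n] assms by simp
      then have "(x = x' \<and> y' = y) \<or> (x = y \<and> y' = x')"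
        using assms(1) Q[OF q(1)] Q[OF q(2)] unfolding sidon_def by blast
      \<comment> \<open>This excludes the degenerate Sidon alternative \<open>x = y\<close>:
        distinct elements of \<open>{0..<int N}\<close> are incongruent modulo
        \<open>N\<close>.\<close>
      moreover have "x \<noteq> y"
      proof
        assume "x = y"
        then have "int N dvd t - s"
          using Q[OF q(1)] by simp
        moreover have "t \<in> {0..<int N}" "s \<in> {0..<int N}"
          using Q[OF q(1)] assms(6) by auto
        ultimately have "t = s"
          by (metis atLeastLessThan_iff mod_eq_dvd_iff mod_pos_pos_trivial)
        with \<open>t \<noteq> s\<close> show False ..
      qed
      ultimately show ?thesis
        by blast
    qed
    define D where "D = {q\<in>Q. snd (fst q) = snd (snd q)}"
    have finQ: "finite Q"
      unfolding Q_def using fin by (auto intro: finite_subset[of _ "(X \<times> B) \<times> (X \<times> B)"])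
    have "card D \<le> card (X \<times> B)"
    proof (rule card_inj_on_le[of fst])
      show "inj_on fst D"
        by (intro inj_onI) (auto simp: D_def, metis diag)
      show "fst ` D \<subseteq> X \<times> B"
        by (auto simp: D_def dest: Q)
    qed (use fin in auto)
    moreover have "card (Q - D) \<le> card (B \<times> B)"
    proof (rule card_inj_on_le[of "\<lambda>q. (snd (fst q), snd (snd q))"])
      show "inj_on (\<lambda>q. (snd (fst q), snd (snd q))) (Q - D)"
        by (intro inj_onI) (auto simp: D_def dest: inj)
      show "(\<lambda>q. (snd (fst q), snd (snd q))) ` (Q - D) \<subseteq> B \<times> B"
        by (auto simp: D_def dest: Q)
    qed (use fin in auto)
    moreover have "card Q = card D + card (Q - D)"
      using finQ by (intro card_Int_Diff[of Q D, THEN trans]) (auto simp: D_def Int_def)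
    ultimately show ?thesis
      by (simp add: card_cartesian_product power2_eq_square)
  qed
  then have "real N * card Q \<le> real N * real (card X * card B + (card B)\<^sup>2)"
    by (intro mult_left_mono) (simp_all only: of_nat_le_iff of_nat_0_le_iff)
  finally show ?thesis
    by simp
qed

section \<open>Bohr cells, on which finitely many characters are nearly constant\<close>

lemma exists_Bohr_cell:
  fixes X :: "int set" and L :: "nat set" and M N :: nat
  assumes "finite X" "finite L" "M > 0"
  obtains D where "D \<subseteq> X" "card X \<le> card D * M ^ card L"
    "\<And>x y r. \<lbrakk>x \<in> D; y \<in> D; r \<in> L\<rbrakk> \<Longrightarrow> \<exists>k::int. \<bar>of_int (int r * (x - y)) / real N - of_int k\<bar> \<le> 1 / real M"
proof -
  \<comment> \<open>Cut the circle into \<open>M\<close> arcs; \<open>\<phi> x\<close> records, for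
    each frequency in \<open>L\<close>, the arc containing \<open>r * x / N\<close> modulo 1. There
    are at most \<open>M ^ card L\<close> patterns, so by pigeonhole the largest fibre serves as
    \<open>D\<close>.\<close>
  define \<phi> where "\<phi> = (\<lambda>x. \<lambda>r\<in>L. nat \<lfloor>real M * frac (of_int (int r * x) / real N)\<rfloor>)"
  define C where "C = (L \<rightarrow>\<^sub>E {..<M})"
  have finC: "finite C" and cardC: "card C = M ^ card L"
    using assms by (simp_all add: C_def finite_PiE card_PiE)
  have \<phi>: "\<phi> x \<in> C" for x
  proof -
    have "nat \<lfloor>real M * frac t\<rfloor> < M" for t
    proof -
      have "real M * frac t < real M * 1"
        using assms frac_lt_1 by (intro mult_strict_left_mono) auto
      then have "\<lfloor>real M * frac t\<rfloor> < int M"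
        by (simp add: floor_less_iff)
      then show ?thesis
        using assms by linarith
    qed
    then show ?thesis
      by (auto simp: \<phi>_def C_def)
  qed
  define fib where "fib = (\<lambda>c. {x\<in>X. \<phi> x = c})"
  have "C \<noteq> {}"
    using \<phi> by blast
  obtain c where c: "c \<in> C" "\<And>c'. c' \<in> C \<Longrightarrow> card (fib c') \<le> card (fib c)"
  proof -
    have "Max ((\<lambda>c. card (fib c)) ` C) \<in> (\<lambda>c. card (fib c)) ` C"
      using finC \<open>C \<noteq> {}\<close> by (intro Max_in) auto
    then obtain c where "c \<in> C" "card (fib c) = Max ((\<lambda>c. card (fib c)) ` C)"
      by force
    then show ?thesis
      using that finC by (metis Max_ge finite_imageI imageI)
  qed
  have "card X = card (\<Union>c\<in>C. fib c)"
    using \<phi> by (intro arg_cong[of _ _ card]) (auto simp: fib_def)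
  also have "\<dots> \<le> (\<Sum>c\<in>C. card (fib c))"
    using finC by (rule card_UN_le)
  also have "\<dots> \<le> card C * card (fib c)"
    using sum_bounded_above[of C "\<lambda>c. card (fib c)" "card (fib c)"] c by simp
  finally have "card X \<le> card (fib c) * M ^ card L"
    by (simp add: cardC mult.commute)
  moreover have "\<exists>k::int. \<bar>of_int (int r * (x - y)) / real N - of_int k\<bar> \<le> 1 / real M"
    if "x \<in> fib c" "y \<in> fib c" "r \<in> L" for x y r
  proof -
    define s t where "s = of_int (int r * x) / real N" and "t = of_int (int r * y) / real N"
    have "\<phi> x r = \<phi> y r"
      using that by (simp add: fib_def)
    then have "nat \<lfloor>real M * frac s\<rfloor> = nat \<lfloor>real M * frac t\<rfloor>"
      using that by (simp add: \<phi>_def s_def t_def)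
    moreover have "\<lfloor>real M * frac s\<rfloor> \<ge> 0" "\<lfloor>real M * frac t\<rfloor> \<ge> 0"
      by (auto simp: frac_ge_0)
    ultimately have "\<lfloor>real M * frac s\<rfloor> = \<lfloor>real M * frac t\<rfloor>"
      by (simp add: eq_nat_nat_iff)
    then have "\<bar>real M * frac s - real M * frac t\<bar> \<le> 1"
      by linarith
    then have "real M * \<bar>frac s - frac t\<bar> \<le> 1"
      using assms by (simp add: abs_mult flip: right_diff_distrib)
    then have "\<bar>frac s - frac t\<bar> \<le> 1 / real M"
      using assms by (simp add: field_simps)
    moreover have "of_int (int r * (x - y)) / real N - of_int (\<lfloor>s\<rfloor> - \<lfloor>t\<rfloor>) = frac s - frac t"
      by (simp add: s_def t_def frac_def diff_divide_distrib right_diff_distrib)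
    ultimately show ?thesis
      by metis
  qed
  moreover have "fib c \<subseteq> X"
    by (auto simp: fib_def)
  ultimately show ?thesis
    using that by blast
qed

text \<open>Distance 1/6 from an integer is an angle of at most \<open>pi / 3\<close>, whose cosine
  is at least 1/2.\<close>

lemma Re_echar_ge_half:
  fixes k q :: int
  assumes "\<bar>of_int k / real N - of_int q\<bar> \<le> 1 / 6"
  shows "1 / 2 \<le> Re (echar N k)"
proof -
  define d where "d = of_int k / real N - of_int q"
  have "Re (echar N k) = cos (2 * pi * d + 2 * pi * of_int q)"
    by (simp add: echar_def d_def ring_distribs)
  also have "\<dots> = cos (2 * pi * d)"
    by (simp add: cos_add)
  also have "\<dots> = cos \<bar>2 * pi * d\<bar>"
    by simp
  also have "\<dots> \<ge> cos (pi / 3)"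
  proof (rule cos_monotone_0_pi_le)
    show "\<bar>2 * pi * d\<bar> \<le> pi / 3"
      using mult_left_mono[OF assms, of "2 * pi"] by (simp add: abs_mult d_def)
  qed auto
  finally show ?thesis
    by (simp add: cos_60)
qed

lemma norm_fourier_squared_ge_half:
  assumes "\<And>x y. \<lbrakk>x \<in> B; y \<in> B\<rbrakk> \<Longrightarrow> 1 / 2 \<le> Re (echar N (k * (x - y)))"
  shows "(real (card B))\<^sup>2 / 2 \<le> (norm (fourier N B k))\<^sup>2"
proof -
  have "(real (card B))\<^sup>2 / 2 = (\<Sum>p\<in>B \<times> B. 1 / 2)"
    by (simp add: card_cartesian_product power2_eq_square)
  also have "\<dots> \<le> (\<Sum>(x, y)\<in>B \<times> B. Re (echar N (k * (x - y))))"
    using assms by (intro sum_mono) auto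
  also have "\<dots> = Re (\<Sum>(x, y)\<in>B \<times> B. echar N (k * (x - y)))"
    by (simp add: case_prod_unfold)
  also have "\<dots> = Re (of_real ((norm (fourier N B k))\<^sup>2))"
    unfolding fourier_def norm_sum_echar_squared[of N k "\<lambda>x. x" B] ..
  finally show ?thesis
    by simp
qed

text \<open>The modulus is large enough that for coefficients \<open>a\<close>, \<open>b\<close> and
  \<open>a + b\<close> the congruences modulo \<open>N\<close> arising from \<open>A\<close> are
  equations in the integers, while \<open>N\<close> stays a constant multiple of
  \<open>n\<close>.\<close>

locale sidon_instance =
  fixes a b n N :: nat and A :: "int set"
  assumes a_pos: "a > 0" and b_pos: "b > 0" and n_pos: "n > 0"
    and N_eq: "N = 2 * (a + b) * n"
    and A_subset: "A \<subseteq> {1..int n}" and A_sidon: "sidon A"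
begin

lemma N_pos: "N > 0"
  using a_pos n_pos by (simp add: N_eq)

lemma finite_A: "finite A"
  using A_subset finite_subset by blast

lemma modulus_bounds:
  "2 * int a * int n \<le> int N" "2 * int b * int n \<le> int N" "2 * int (a + b) * int n \<le> int N"
  by (simp_all add: N_eq algebra_simps)

lemma card_A_squared_le: "(real (card A))\<^sup>2 \<le> 2 * real N"
  using sidon_card_squared_le[OF A_sidon A_subset _ modulus_bounds(1) n_pos] a_pos by simp

lemma fourth_moment_le:
  assumes "D \<subseteq> A" "c > 0" "2 * c * int n \<le> int N"
  shows "(\<Sum>r<N. norm (fourier N D (c * int r)) ^ 4) \<le> 4 * (real N)\<^sup>2"
proof -
  have "(\<Sum>r<N. norm (fourier N D (c * int r)) ^ 4) \<le> 2 * real N * (real (card D))\<^sup>2"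
    using fourth_moment_sidon[of D n c N] assms A_sidon A_subset n_pos sidon_subset by blast
  also have "\<dots> \<le> 2 * real N * (real (card A))\<^sup>2"
    using assms finite_A by (intro mult_left_mono power_mono) (auto intro: card_mono)
  also have "\<dots> \<le> 2 * real N * (2 * real N)"
    using card_A_squared_le by (intro mult_left_mono) auto
  finally show ?thesis
    by (simp add: power2_eq_square)
qed

section \<open>The large spectrum: its size and its energy\<close>

definition amp :: "nat \<Rightarrow> real" where
  "amp r = norm (fourier N A (int a * int r))"

text \<open>The scale \<open>sqrt N\<close> is the largest possible order of \<open>card A\<close>,
  so \<open>\<eta>\<close> can be chosen independently of \<open>n\<close>.\<close>

definition spec :: "real \<Rightarrow> nat set" where
  "spec \<eta> = {r. r < N \<and> \<eta> * sqrt (real N) \<le> amp r}"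

definition energy :: "nat set \<Rightarrow> real" where
  "energy S = (\<Sum>r\<in>S. (amp r)\<^sup>2)"

lemma amp_nonneg [simp]: "amp r \<ge> 0"
  by (simp add: amp_def)

lemma finite_spec [simp]: "finite (spec \<eta>)"
  by (simp add: spec_def)

lemma spec_antimono: "\<eta>' \<le> \<eta> \<Longrightarrow> spec \<eta> \<subseteq> spec \<eta>'"
  using N_pos by (auto simp: spec_def intro: order_trans[OF mult_right_mono])

lemma energy_nonneg: "energy S \<ge> 0"
  by (simp add: energy_def sum_nonneg)

lemma energy_Diff: "finite T \<Longrightarrow> S \<subseteq> T \<Longrightarrow> energy (T - S) = energy T - energy S"
  by (simp add: energy_def sum_diff)

text \<open>Markov's inequality for the fourth moment. The bound does not depend on
  \<open>N\<close>, so cells for the spectrum lose only a constant factor.\<close>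

lemma card_spec_le:
  assumes "\<eta> > 0"
  shows "card (spec \<eta>) \<le> nat \<lceil>4 / \<eta> ^ 4\<rceil>"
proof -
  have "real (card (spec \<eta>)) * (\<eta> ^ 4 * (real N)\<^sup>2) = (\<Sum>r\<in>spec \<eta>. (\<eta> * sqrt (real N)) ^ 4)"
    by (simp add: power_mult_distrib power4_eq_xxxx power2_eq_square)
  also have "\<dots> \<le> (\<Sum>r\<in>spec \<eta>. amp r ^ 4)"
    using assms by (intro sum_mono power_mono) (auto simp: spec_def)
  also have "\<dots> \<le> (\<Sum>r<N. amp r ^ 4)"
    by (intro sum_mono2) (auto simp: spec_def)
  also have "\<dots> \<le> 4 * (real N)\<^sup>2"
    unfolding amp_def using a_pos modulus_bounds by (intro fourth_moment_le) auto
  finally have "real (card (spec \<eta>)) * \<eta> ^ 4 * (real N)\<^sup>2 \<le> 4 * (real N)\<^sup>2"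
    by (simp add: mult_ac)
  moreover have "(real N)\<^sup>2 > 0"
    using N_pos by simp
  ultimately have "real (card (spec \<eta>)) * \<eta> ^ 4 \<le> 4"
    by (rule mult_right_le_imp_le)
  then have "real (card (spec \<eta>)) \<le> 4 / \<eta> ^ 4"
    using assms by (simp add: field_simps)
  then show ?thesis
    by linarith
qed

text \<open>Parseval only gives the square sum \<open>N * card A\<close>, which is useless for sparse \<open>A\<close>.
  Smoothing by a cell \<open>B\<close> on which the characters of the spectrum are nearly constant
  improves this to \<open>O(N)\<close>: by the Sidon property each nonzero element of \<open>B - B\<close>
  is represented at most once as \<open>a (x - y)\<close>.\<close>

lemma energy_spec_le:
  assumes "\<eta> > 0" and large: "2 * (6 * (real a + real b)) ^ (2 * nat \<lceil>4 / \<eta> ^ 4\<rceil>) \<le> real N"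
  shows "energy (spec \<eta>) \<le> 4 * real N"
proof -
  define M where "M = 6 * (a + b)"
  define \<kappa> where "\<kappa> = nat \<lceil>4 / \<eta> ^ 4\<rceil>"
  have M: "M > 0" "real M = 6 * (real a + real b)"
    using a_pos by (auto simp: M_def)
  obtain B where B: "B \<subseteq> {0..<int N}" "card {0..<int N} \<le> card B * M ^ card (spec \<eta>)"
    "\<And>x y r. \<lbrakk>x \<in> B; y \<in> B; r \<in> spec \<eta>\<rbrakk>
      \<Longrightarrow> \<exists>k::int. \<bar>of_int (int r * (x - y)) / real N - of_int k\<bar> \<le> 1 / real M"
    using exists_Bohr_cell[of "{0..<int N}" "spec \<eta>" M N] M by auto
  have "N \<le> card B * M ^ card (spec \<eta>)"
    using B(2) by simp
  also have "\<dots> \<le> card B * M ^ \<kappa>"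
    using card_spec_le[OF assms(1)] M by (intro mult_left_mono power_increasing) (auto simp: \<kappa>_def)
  finally have NB: "N \<le> card B * M ^ \<kappa>" .
  then have B_pos: "card B > 0"
    using N_pos by (intro gr0I) auto
  \<comment> \<open>The cell keeps a fixed proportion of all residues, whereas \<open>card A\<close>
    is at most \<open>sqrt (2 * N)\<close>; so \<open>large\<close> makes \<open>B\<close> the
    bigger set, and the term \<open>card A * card B\<close> of the mixed moment is absorbed into
    \<open>card B\<close> squared.\<close>
  have AB: "real (card A) \<le> real (card B)"
  proof -
    have "(real (card A) * real M ^ \<kappa>)\<^sup>2 \<le> (2 * real N) * (real M ^ \<kappa>)\<^sup>2"
      unfolding power_mult_distrib using card_A_squared_le by (intro mult_right_mono) auto
    also have "\<dots> = real N * (2 * real M ^ (2 * \<kappa>))"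
      by (simp add: power_mult power2_eq_square power_mult_distrib mult.commute[of 2])
    also have "\<dots> \<le> (real N)\<^sup>2"
      using large unfolding power2_eq_square M(2) \<kappa>_def by (intro mult_left_mono) auto
    finally have "real (card A) * real M ^ \<kappa> \<le> real N"
      by (rule power2_le_imp_le) simp
    also have "\<dots> \<le> real (card B) * real M ^ \<kappa>"
      using NB by (metis of_nat_le_iff of_nat_mult of_nat_power)
    finally show ?thesis
      using M by simp
  qed
  have cell: "(real (card B))\<^sup>2 / 2 \<le> (norm (fourier N B (int r)))\<^sup>2" if "r \<in> spec \<eta>" for r
  proof (rule norm_fourier_squared_ge_half)
    fix x y assume "x \<in> B" "y \<in> B"
    then obtain k :: int where "\<bar>of_int (int r * (x - y)) / real N - of_int k\<bar> \<le> 1 / real M"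
      using B(3) \<open>r \<in> spec \<eta>\<close> by blast
    moreover have "1 / real M \<le> 1 / 6"
      using a_pos by (simp add: M_def field_simps)
    ultimately show "1 / 2 \<le> Re (echar N (int r * (x - y)))"
      by (intro Re_echar_ge_half[of _ _ k]) linarith
  qed
  have "energy (spec \<eta>) * ((real (card B))\<^sup>2 / 2) = (\<Sum>r\<in>spec \<eta>. (amp r)\<^sup>2 * ((real (card B))\<^sup>2 / 2))"
    by (simp add: energy_def sum_distrib_right)
  also have "\<dots> \<le> (\<Sum>r\<in>spec \<eta>. (amp r)\<^sup>2 * (norm (fourier N B (int r)))\<^sup>2)"
    using cell by (intro sum_mono mult_left_mono) auto
  also have "\<dots> \<le> (\<Sum>r<N. (amp r)\<^sup>2 * (norm (fourier N B (int r)))\<^sup>2)"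
    by (intro sum_mono2) (auto simp: spec_def)
  also have "\<dots> \<le> real N * (real (card A) * real (card B) + (real (card B))\<^sup>2)"
    unfolding amp_def using mixed_moment_sidon[OF A_sidon A_subset _ modulus_bounds(1) n_pos B(1)] a_pos by simp
  also have "\<dots> \<le> real N * (real (card B) * real (card B) + (real (card B))\<^sup>2)"
    using AB by (intro mult_left_mono add_right_mono mult_right_mono) auto
  also have "\<dots> = (4 * real N) * ((real (card B))\<^sup>2 / 2)"
    by (simp add: power2_eq_square)
  finally have "energy (spec \<eta>) * ((real (card B))\<^sup>2 / 2) \<le> (4 * real N) * ((real (card B))\<^sup>2 / 2)" .
  moreover have "(real (card B))\<^sup>2 / 2 > 0"
    using B_pos by simp
  ultimately show ?thesis
    by (rule mult_right_le_imp_le)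
qed

section \<open>Counting solutions by Fourier inversion\<close>

definition solutions :: "int set \<Rightarrow> (int \<times> int \<times> int \<times> int \<times> int) set" where
  "solutions D = {(x1, x4, x2, x3, x5) \<in> A \<times> A \<times> D \<times> D \<times> D. is_solution a b x1 x2 x3 x4 x5}"

text \<open>The variables \<open>x1\<close> and \<open>x4\<close> carry the same coefficient
  \<open>a\<close> on opposite sides, so their transforms multiply to the nonnegative weight
  \<open>amp r\<close> squared.\<close>

lemma card_solutions_Fourier:
  assumes "D \<subseteq> A"
  shows "real N * real (card (solutions D)) = (\<Sum>r<N. (amp r)\<^sup>2 *
    Re (fourier N D (int a * int r) * fourier N D (int b * int r) * cnj (fourier N D (int (a + b) * int r))))"
proof -
  define u :: "int \<times> int \<times> int \<times> int \<times> int \<Rightarrow> int"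
    where "u = (\<lambda>(x1, x4, x2, x3, x5). int a * x1 - int a * x4 + int a * x2 + int b * x3 - int (a + b) * x5)"
  define I where "I = A \<times> A \<times> D \<times> D \<times> D"
  have finD: "finite D"
    using assms finite_A finite_subset by blast
  have "{i\<in>I. int N dvd u i} = solutions D"
  proof (intro equalityI subsetI)
    fix i assume "i \<in> {i\<in>I. int N dvd u i}"
    then obtain x1 x2 x3 x4 x5 where i: "i = (x1, x4, x2, x3, x5)"
      and x: "x1 \<in> A" "x4 \<in> A" "x2 \<in> D" "x3 \<in> D" "x5 \<in> D"
      and dvd: "int N dvd u (x1, x4, x2, x3, x5)"
      by (auto simp: I_def)
    have bd: "1 \<le> x \<and> x \<le> int n" if "x \<in> A" for x
      using that A_subset by auto
    have d: "\<bar>x - y\<bar> \<le> int n - 1" if "x \<in> A" "y \<in> A" for x y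
      using bd[of x] bd[of y] that by linarith
    have "u (x1, x4, x2, x3, x5) = int a * (x1 - x4) + int a * (x2 - x5) + int b * (x3 - x5)"
      by (simp add: u_def algebra_simps)
    \<comment> \<open>The form is at most \<open>(2 * a + b) * (n - 1)\<close> in modulus, which is
      below \<open>N\<close>, so a congruence modulo \<open>N\<close> is a true solution.\<close>
    also have "\<bar>\<dots>\<bar> \<le> int a * \<bar>x1 - x4\<bar> + int a * \<bar>x2 - x5\<bar> + int b * \<bar>x3 - x5\<bar>"
      by (intro order_trans[OF abs_triangle_ineq] add_mono) (simp_all add: abs_mult)
    also have "\<dots> \<le> int a * (int n - 1) + int a * (int n - 1) + int b * (int n - 1)"
      using x assms by (intro add_mono mult_left_mono d) auto
    also have "\<dots> < int N"
      using a_pos b_pos by (simp add: N_eq algebra_simps add_pos_nonneg)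
    finally have "u (x1, x4, x2, x3, x5) = 0"
      using dvd by (meson zdvd_imp_le zdvd_not_zless abs_ge_zero dvd_abs_iff not_less zero_less_abs_iff)
    then show "i \<in> solutions D"
      using x by (simp add: i solutions_def is_solution_def u_def algebra_simps)
  next
    fix i assume "i \<in> solutions D"
    then obtain x1 x2 x3 x4 x5 where i: "i = (x1, x4, x2, x3, x5)"
      and x: "x1 \<in> A" "x4 \<in> A" "x2 \<in> D" "x3 \<in> D" "x5 \<in> D" and sol: "is_solution a b x1 x2 x3 x4 x5"
      by (auto simp: solutions_def)
    from sol have "u i = 0"
      by (simp add: i u_def is_solution_def algebra_simps)
    then show "i \<in> {i\<in>I. int N dvd u i}"
      using x by (simp add: i I_def)
  qed
  then have "complex_of_nat (N * card (solutions D)) = (\<Sum>r<N. \<Sum>i\<in>I. echar N (int r * u i))"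
    using sum_echar_eq_card[OF N_pos, of I u] finD finite_A by (simp add: I_def)
  also have "\<dots> = (\<Sum>r<N. of_real ((amp r)\<^sup>2) *
    (fourier N D (int a * int r) * fourier N D (int b * int r) * cnj (fourier N D (int (a + b) * int r))))"
  proof (intro sum.cong refl)
    fix r
    have e: "echar N (int r * u (x1, x4, x2, x3, x5)) =
       echar N (int a * int r * x1) * (cnj (echar N (int a * int r * x4)) * (echar N (int a * int r * x2) *
         (echar N (int b * int r * x3) * cnj (echar N (int (a + b) * int r * x5)))))" for x1 x2 x3 x4 x5
    proof -
      have "int r * u (x1, x4, x2, x3, x5) = int a * int r * x1 - int a * int r * x4 + int a * int r * x2
          + int b * int r * x3 - int (a + b) * int r * x5"
        by (simp add: u_def algebra_simps)
      then show ?thesis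
        by (simp only: echar_add echar_diff mult.assoc)
    qed
    have "(\<Sum>i\<in>I. echar N (int r * u i)) = fourier N A (int a * int r) * (cnj (fourier N A (int a * int r)) *
        (fourier N D (int a * int r) * (fourier N D (int b * int r) * cnj (fourier N D (int (a + b) * int r)))))"
      unfolding fourier_def cnj_sum sum_product sum.cartesian_product I_def
      by (intro sum.cong refl) (auto simp: e sum_distrib_left sum.cartesian_product)
    then show "(\<Sum>i\<in>I. echar N (int r * u i)) = of_real ((amp r)\<^sup>2) *
      (fourier N D (int a * int r) * fourier N D (int b * int r) * cnj (fourier N D (int (a + b) * int r)))"
      unfolding amp_def complex_norm_square by (simp add: mult.assoc)
  qed
  finally have "Re (complex_of_nat (N * card (solutions D))) = Re \<dots>"
    by (rule arg_cong)
  moreover have "Re (of_real x * z) = x * Re z" for x z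
    by simp
  ultimately show ?thesis
    by (simp only: Re_sum complex_Re_of_nat) simp
qed

text \<open>The frequencies split at both thresholds. Frequency 0 yields the main term, the gap
  between the thresholds costs at most half of it by \<open>mid\<close>, and the frequencies below
  \<open>\<eta>'\<close> give the subtracted error.\<close>

lemma exists_cell_many_solutions:
  assumes "0 < \<eta>" "\<eta> \<le> \<delta>" "0 < \<eta>'" "\<eta>' \<le> \<eta>" "\<delta> * sqrt (real N) \<le> real (card A)"
    and mid: "energy (spec \<eta>') - energy (spec \<eta>) \<le> \<delta>\<^sup>2 / 2 * real N"
  obtains D where "D \<subseteq> A" "card A \<le> card D * (6 * (a + b)) ^ nat \<lceil>4 / \<eta> ^ 4\<rceil>"
    "\<delta>\<^sup>2 / 2 * real N * real (card D) ^ 3 - 4 * \<eta>' * (real N)\<^sup>2 * sqrt (real N)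
      \<le> real N * real (card (solutions D))"
proof -
  \<comment> \<open>The two deviations, weighted by \<open>a\<close> and \<open>b\<close>, then add
    up to at most \<open>(a + b) / M = 1 / 6\<close>.\<close>
  define M where "M = 6 * (a + b)"
  have M: "M > 0"
    using a_pos by (auto simp: M_def)
  obtain D where D: "D \<subseteq> A" "card A \<le> card D * M ^ card (spec \<eta>)"
    "\<And>x y r. \<lbrakk>x \<in> D; y \<in> D; r \<in> spec \<eta>\<rbrakk>
      \<Longrightarrow> \<exists>k::int. \<bar>of_int (int r * (x - y)) / real N - of_int k\<bar> \<le> 1 / real M"
    using exists_Bohr_cell[of A "spec \<eta>" M N] M finite_A by auto
  note D(2)
  also have "card D * M ^ card (spec \<eta>) \<le> card D * M ^ nat \<lceil>4 / \<eta> ^ 4\<rceil>"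
    using card_spec_le[OF assms(1)] M by (intro mult_left_mono power_increasing) auto
  finally have cardD: "card A \<le> card D * (6 * (a + b)) ^ nat \<lceil>4 / \<eta> ^ 4\<rceil>"
    by (simp add: M_def)
  define F where "F = (\<lambda>c r. norm (fourier N D (int c * int r)))"
  define G where "G = (\<lambda>r. fourier N D (int a * int r) * fourier N D (int b * int r)
    * cnj (fourier N D (int (a + b) * int r)))"
  have norm_G: "norm (G r) = F a r * F b r * F (a + b) r" for r
    by (simp add: G_def F_def norm_mult)
  have F_nonneg: "F c r \<ge> 0" and F_le: "F c r \<le> card D" for c r
    by (simp_all add: F_def norm_fourier_le)
  have G_le: "norm (G r) \<le> real (card D) ^ 3" for r
    unfolding norm_G power3_eq_cube using F_nonneg F_le by (intro mult_mono mult_nonneg_nonneg) auto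
  have G_ge: "- (x * real (card D) ^ 3) \<le> x * Re (G r)" if "x \<ge> 0" for x r
  proof -
    have "- (real (card D) ^ 3) \<le> Re (G r)"
      using G_le[of r] abs_Re_le_cmod[of "G r"] by linarith
    from mult_left_mono[OF this that] show ?thesis
      by simp
  qed
  have G_spec: "0 \<le> Re (G r)" if "r \<in> spec \<eta>" for r
  proof -
    \<comment> \<open>Since the coefficients sum to zero, the form depends only on the differences
      \<open>x - z\<close> and \<open>y - z\<close>, which the cell controls.\<close>
    have "G r = (\<Sum>x\<in>D. \<Sum>y\<in>D. \<Sum>z\<in>D. echar N (int r * (int a * (x - z) + int b * (y - z))))"
    proof -
      have "G r = (\<Sum>x\<in>D. \<Sum>y\<in>D. \<Sum>z\<in>D. echar N (int a * int r * x) * echar N (int b * int r * y)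
          * cnj (echar N (int (a + b) * int r * z)))"
        unfolding G_def fourier_def cnj_sum
        by (subst sum_product, simp only: sum_distrib_right) (simp only: sum_distrib_left)
      also have "\<dots> = (\<Sum>x\<in>D. \<Sum>y\<in>D. \<Sum>z\<in>D. echar N (int r * (int a * (x - z) + int b * (y - z))))"
      proof (intro sum.cong refl)
        fix x y z
        have "int r * (int a * (x - z) + int b * (y - z))
            = int a * int r * x + int b * int r * y - int (a + b) * int r * z"
          by (simp add: algebra_simps)
        then show "echar N (int a * int r * x) * echar N (int b * int r * y)
            * cnj (echar N (int (a + b) * int r * z)) = echar N (int r * (int a * (x - z) + int b * (y - z)))"
          by (simp only: echar_add echar_diff)
      qed
      finally show ?thesis .
    qed
    moreover have "0 \<le> Re (echar N (int r * (int a * (x - z) + int b * (y - z))))"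
      if xyz: "x \<in> D" "y \<in> D" "z \<in> D" for x y z
    proof -
      obtain k :: int where k: "\<bar>of_int (int r * (x - z)) / real N - of_int k\<bar> \<le> 1 / real M"
        using D(3) xyz \<open>r \<in> spec \<eta>\<close> by blast
      obtain l :: int where l: "\<bar>of_int (int r * (y - z)) / real N - of_int l\<bar> \<le> 1 / real M"
        using D(3) xyz \<open>r \<in> spec \<eta>\<close> by blast
      have "of_int (int r * (int a * (x - z) + int b * (y - z))) / real N - of_int (int a * k + int b * l)
          = real a * (of_int (int r * (x - z)) / real N - of_int k)
            + real b * (of_int (int r * (y - z)) / real N - of_int l)"
        by (simp add: algebra_simps add_divide_distrib diff_divide_distrib)
      also have "\<bar>\<dots>\<bar> \<le> real a * \<bar>of_int (int r * (x - z)) / real N - of_int k\<bar>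
            + real b * \<bar>of_int (int r * (y - z)) / real N - of_int l\<bar>"
        by (rule order_trans[OF abs_triangle_ineq]) (simp add: abs_mult)
      also have "\<dots> \<le> real a * (1 / real M) + real b * (1 / real M)"
        by (intro add_mono mult_left_mono k l) auto
      also have "\<dots> = (real a + real b) / (6 * (real a + real b))"
        by (simp add: M_def add_divide_distrib)
      also have "\<dots> = 1 / 6"
        using a_pos by simp
      finally show ?thesis
        using Re_echar_ge_half by fastforce
    qed
    ultimately show ?thesis
      by (simp add: sum_nonneg)
  qed
  have zero_spec: "0 \<in> spec \<eta>"
  proof -
    have "\<eta> * sqrt (real N) \<le> \<delta> * sqrt (real N)"
      using assms by (intro mult_right_mono) auto
    also note assms(5)
    finally show ?thesis
      using N_pos by (simp add: spec_def amp_def)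
  qed
  have main: "\<delta>\<^sup>2 * real N * real (card D) ^ 3 \<le> (\<Sum>r\<in>spec \<eta>. (amp r)\<^sup>2 * Re (G r))"
  proof -
    have "(\<delta> * sqrt (real N))\<^sup>2 \<le> (real (card A))\<^sup>2"
      using assms by (intro power_mono) auto
    then have "\<delta>\<^sup>2 * real N * real (card D) ^ 3 \<le> (real (card A))\<^sup>2 * real (card D) ^ 3"
      by (intro mult_right_mono) (auto simp: power_mult_distrib)
    also have "\<dots> = (amp 0)\<^sup>2 * Re (G 0)"
      by (simp add: amp_def G_def power3_eq_cube)
    also have "\<dots> \<le> (\<Sum>r\<in>spec \<eta>. (amp r)\<^sup>2 * Re (G r))"
      using zero_spec G_spec by (intro member_le_sum) auto
    finally show ?thesis .
  qed
  \<comment> \<open>Here \<open>G\<close> has no known sign; it is bounded trivially by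
    \<open>card D ^ 3\<close>, and the small energy of the gap compensates.\<close>
  have middle: "- (\<delta>\<^sup>2 / 2 * real N * real (card D) ^ 3) \<le> (\<Sum>r\<in>spec \<eta>' - spec \<eta>. (amp r)\<^sup>2 * Re (G r))"
  proof -
    have "energy (spec \<eta>' - spec \<eta>) * real (card D) ^ 3 \<le> \<delta>\<^sup>2 / 2 * real N * real (card D) ^ 3"
      using mid energy_Diff spec_antimono assms by (intro mult_right_mono) auto
    then have "- (\<delta>\<^sup>2 / 2 * real N * real (card D) ^ 3)
        \<le> (\<Sum>r\<in>spec \<eta>' - spec \<eta>. - ((amp r)\<^sup>2 * real (card D) ^ 3))"
      by (simp add: energy_def sum_negf sum_distrib_right)
    also have "\<dots> \<le> (\<Sum>r\<in>spec \<eta>' - spec \<eta>. (amp r)\<^sup>2 * Re (G r))"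
      by (intro sum_mono G_ge) auto
    finally show ?thesis .
  qed
  have small: "- (4 * \<eta>' * (real N)\<^sup>2 * sqrt (real N)) \<le> (\<Sum>r\<in>{..<N} - spec \<eta>'. (amp r)\<^sup>2 * Re (G r))"
  proof -
    \<comment> \<open>One factor \<open>amp r\<close> is traded for \<open>\<eta>' * sqrt N\<close>.
      Four transforms remain, and the inequality of arithmetic and geometric means reduces their
      product to fourth moments.\<close>
    have "(\<Sum>r\<in>{..<N} - spec \<eta>'. (amp r)\<^sup>2 * norm (G r))
        \<le> (\<Sum>r\<in>{..<N} - spec \<eta>'. \<eta>' * sqrt (real N) * (amp r * norm (G r)))"
    proof (intro sum_mono)
      fix r assume "r \<in> {..<N} - spec \<eta>'"
      then have "amp r \<le> \<eta>' * sqrt (real N)"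
        by (auto simp: spec_def)
      then have "amp r * (amp r * norm (G r)) \<le> \<eta>' * sqrt (real N) * (amp r * norm (G r))"
        by (intro mult_right_mono) auto
      then show "(amp r)\<^sup>2 * norm (G r) \<le> \<eta>' * sqrt (real N) * (amp r * norm (G r))"
        by (simp add: power2_eq_square mult.assoc)
    qed
    also have "\<dots> \<le> (\<Sum>r<N. \<eta>' * sqrt (real N) * (amp r * norm (G r)))"
      using assms by (intro sum_mono2) auto
    also have "\<dots> = \<eta>' * sqrt (real N) * (\<Sum>r<N. amp r * norm (G r))"
      by (simp add: sum_distrib_left)
    also have "(\<Sum>r<N. amp r * norm (G r))
        \<le> (\<Sum>r<N. (amp r ^ 4 + F a r ^ 4 + F b r ^ 4 + F (a + b) r ^ 4) / 4)"
    proof (intro sum_mono)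
      fix r
      have "x * (y * z * w) \<le> (x ^ 4 + y ^ 4 + z ^ 4 + w ^ 4) / 4" for x y z w :: real
      proof -
        have "x * (y * z * w) \<le> ((x * y)\<^sup>2 + (z * w)\<^sup>2) / 2"
          using sum_squares_bound[of "x * y" "z * w"] by (simp add: mult_ac)
        moreover have "(x * y)\<^sup>2 \<le> (x ^ 4 + y ^ 4) / 2" "(z * w)\<^sup>2 \<le> (z ^ 4 + w ^ 4) / 2"
          using sum_squares_bound[of "x\<^sup>2" "y\<^sup>2"] sum_squares_bound[of "z\<^sup>2" "w\<^sup>2"]
          by (simp_all add: power_mult_distrib)
        ultimately show ?thesis
          by argo
      qed
      then show "amp r * norm (G r) \<le> (amp r ^ 4 + F a r ^ 4 + F b r ^ 4 + F (a + b) r ^ 4) / 4"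
        unfolding norm_G .
    qed
    also have "\<dots> = ((\<Sum>r<N. amp r ^ 4) + (\<Sum>r<N. F a r ^ 4) + (\<Sum>r<N. F b r ^ 4) + (\<Sum>r<N. F (a + b) r ^ 4)) / 4"
      by (simp only: sum.distrib flip: sum_divide_distrib)
    also have "\<dots> \<le> (4 * (real N)\<^sup>2 + 4 * (real N)\<^sup>2 + 4 * (real N)\<^sup>2 + 4 * (real N)\<^sup>2) / 4"
      unfolding amp_def F_def using D(1) a_pos b_pos modulus_bounds
      by (intro divide_right_mono add_mono fourth_moment_le) auto
    also have "\<eta>' * sqrt (real N) * \<dots> = 4 * \<eta>' * (real N)\<^sup>2 * sqrt (real N)"
      by simp
    finally have "(\<Sum>r\<in>{..<N} - spec \<eta>'. (amp r)\<^sup>2 * norm (G r)) \<le> 4 * \<eta>' * (real N)\<^sup>2 * sqrt (real N)"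
      using assms by (simp add: mult_left_mono)
    moreover have "(\<Sum>r\<in>{..<N} - spec \<eta>'. - ((amp r)\<^sup>2 * norm (G r)))
        \<le> (\<Sum>r\<in>{..<N} - spec \<eta>'. (amp r)\<^sup>2 * Re (G r))"
    proof (intro sum_mono)
      fix r
      have "- norm (G r) \<le> Re (G r)"
        using abs_Re_le_cmod[of "G r"] by linarith
      from mult_left_mono[OF this, of "(amp r)\<^sup>2"]
      show "- ((amp r)\<^sup>2 * norm (G r)) \<le> (amp r)\<^sup>2 * Re (G r)"
        by simp
    qed
    ultimately show ?thesis
      by (simp add: sum_negf)
  qed
  have "real N * real (card (solutions D)) = (\<Sum>r<N. (amp r)\<^sup>2 * Re (G r))"
    unfolding G_def by (rule card_solutions_Fourier[OF D(1)])
  also have "\<dots> = (\<Sum>r\<in>{..<N} - spec \<eta>'. (amp r)\<^sup>2 * Re (G r)) + (\<Sum>r\<in>spec \<eta>'. (amp r)\<^sup>2 * Re (G r))"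
    by (intro sum.subset_diff) (auto simp: spec_def)
  also have "(\<Sum>r\<in>spec \<eta>'. (amp r)\<^sup>2 * Re (G r))
      = (\<Sum>r\<in>spec \<eta>' - spec \<eta>. (amp r)\<^sup>2 * Re (G r)) + (\<Sum>r\<in>spec \<eta>. (amp r)\<^sup>2 * Re (G r))"
    using assms by (intro sum.subset_diff spec_antimono) auto
  finally have "\<delta>\<^sup>2 / 2 * real N * real (card D) ^ 3 - 4 * \<eta>' * (real N)\<^sup>2 * sqrt (real N)
      \<le> real N * real (card (solutions D))"
    using main middle small by simp
  with D(1) cardD that show ?thesis
    by blast
qed

section \<open>Few trivial solutions, hence an energy increment\<close>

lemma card_trivial_solutions_le:
  assumes "D \<subseteq> A"
    and "\<And>x1 x2 x3 x4 x5. (x1, x4, x2, x3, x5) \<in> solutions D \<Longrightarrow> trivial_sol a b x1 x2 x3 x4 x5"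
  shows "card (solutions D) \<le> 3 * (card A)\<^sup>2"
proof -
  \<comment> \<open>One map per trivial family, in the order \<open>(x1, x4, x2, x3, x5)\<close> of
    \<open>solutions\<close>. In all three the parameters are \<open>x = x4\<close> and
    \<open>y = x5\<close>.\<close>
  define f1 f2 f3 :: "int \<times> int \<Rightarrow> int \<times> int \<times> int \<times> int \<times> int"
    where "f1 = (\<lambda>(x, y). (x, x, y, y, y))" and "f2 = (\<lambda>(x, y). (y, x, x, y, y))"
      and "f3 = (\<lambda>(x, y). (y, x, y, x, y))"
  have "solutions D \<subseteq> f1 ` (A \<times> A) \<union> f2 ` (A \<times> A) \<union> f3 ` (A \<times> A)"
  proof
    fix i assume i: "i \<in> solutions D"
    obtain x1 x2 x3 x4 x5 where eq: "i = (x1, x4, x2, x3, x5)"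
      by (metis surj_pair)
    have x: "x1 \<in> A" "x4 \<in> A" "x2 \<in> A" "x3 \<in> A" "x5 \<in> A"
      using i assms(1) unfolding eq solutions_def by auto
    have "trivial_sol a b x1 x2 x3 x4 x5"
      using assms(2) i eq by blast
    then obtain x y where "i = f1 (x, y) \<or> i = f2 (x, y) \<or> i = f3 (x, y)" "x = x4" "y = x5"
      unfolding trivial_sol_def eq f1_def f2_def f3_def by auto
    with x show "i \<in> f1 ` (A \<times> A) \<union> f2 ` (A \<times> A) \<union> f3 ` (A \<times> A)"
      by blast
  qed
  then have "card (solutions D) \<le> card (f1 ` (A \<times> A) \<union> f2 ` (A \<times> A) \<union> f3 ` (A \<times> A))"
    using finite_A by (intro card_mono) auto
  also have "\<dots> \<le> card (f1 ` (A \<times> A)) + card (f2 ` (A \<times> A)) + card (f3 ` (A \<times> A))"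
    using card_Un_le[of "f1 ` (A \<times> A) \<union> f2 ` (A \<times> A)" "f3 ` (A \<times> A)"]
      card_Un_le[of "f1 ` (A \<times> A)" "f2 ` (A \<times> A)"] by linarith
  also have "\<dots> \<le> card (A \<times> A) + card (A \<times> A) + card (A \<times> A)"
    using finite_A by (intro add_mono card_image_le) auto
  finally show ?thesis
    by (simp add: card_cartesian_product power2_eq_square)
qed

text \<open>Otherwise the cell \<open>D\<close> provides at least
  \<open>4 * \<eta>' * N * sqrt N\<close> solutions, whereas the trivial ones number at most
  \<open>6 * N\<close>; \<open>large\<close> makes this a contradiction.\<close>

lemma energy_increment:
  assumes "0 < \<eta>" "\<eta> \<le> \<delta>" "0 < \<eta>'" "\<eta>' \<le> \<eta>" "\<delta> * sqrt (real N) \<le> real (card A)"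
    and \<eta>': "16 * \<eta>' * (6 * (real a + real b)) ^ (3 * nat \<lceil>4 / \<eta> ^ 4\<rceil>) \<le> \<delta> ^ 5"
    and large: "3 < 2 * \<eta>' * sqrt (real N)"
    and trivial: "\<And>x1 x2 x3 x4 x5. \<lbrakk>x1 \<in> A; x2 \<in> A; x3 \<in> A; x4 \<in> A; x5 \<in> A; is_solution a b x1 x2 x3 x4 x5\<rbrakk>
      \<Longrightarrow> trivial_sol a b x1 x2 x3 x4 x5"
  shows "energy (spec \<eta>) + \<delta>\<^sup>2 / 2 * real N < energy (spec \<eta>')"
proof (rule ccontr)
  assume "\<not> ?thesis"
  then have mid: "energy (spec \<eta>') - energy (spec \<eta>) \<le> \<delta>\<^sup>2 / 2 * real N"
    by simp
  \<comment> \<open>The density lost in passing from \<open>A\<close> to \<open>D\<close>. The main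
    term is cubic in \<open>card D\<close>, hence the exponent 3 in the hypothesis on
    \<open>\<eta>'\<close>.\<close>
  define P where "P = (6 * (real a + real b)) ^ nat \<lceil>4 / \<eta> ^ 4\<rceil>"
  have P: "P > 0"
    unfolding P_def using a_pos by (intro zero_less_power) auto
  obtain D where D: "D \<subseteq> A" "card A \<le> card D * (6 * (a + b)) ^ nat \<lceil>4 / \<eta> ^ 4\<rceil>"
    "\<delta>\<^sup>2 / 2 * real N * real (card D) ^ 3 - 4 * \<eta>' * (real N)\<^sup>2 * sqrt (real N)
      \<le> real N * real (card (solutions D))"
    using exists_cell_many_solutions[OF assms(1-5) mid] by blast
  define q where "q = (real N)\<^sup>2 * sqrt (real N)"
  have q: "q > 0"
    using N_pos by (simp add: q_def)
  have "real (card A) \<le> real (card D * (6 * (a + b)) ^ nat \<lceil>4 / \<eta> ^ 4\<rceil>)"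
    using D(2) by (simp only: of_nat_le_iff)
  then have "\<delta> * sqrt (real N) \<le> real (card D) * P"
    using assms(5) by (simp add: P_def)
  then have "(\<delta> * sqrt (real N)) ^ 3 \<le> (real (card D) * P) ^ 3"
    using assms by (intro power_mono) auto
  moreover have sqrt_cube: "sqrt (real N) ^ 3 = real N * sqrt (real N)"
    by (simp add: power3_eq_cube)
  ultimately have cube: "\<delta> ^ 3 * (real N * sqrt (real N)) \<le> real (card D) ^ 3 * P ^ 3"
    by (simp add: power_mult_distrib sqrt_cube)
  \<comment> \<open>The low-frequency error \<open>4 * \<eta>' * q\<close> is thus at most half of
    the remaining main term.\<close>
  have "8 * \<eta>' * q * P ^ 3 = (16 * \<eta>' * P ^ 3) * q / 2"
    by simp
  also have "\<dots> \<le> \<delta> ^ 5 * q / 2"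
    using \<eta>' q by (intro divide_right_mono mult_right_mono) (auto simp: P_def mult.commute simp flip: power_mult)
  also have "\<dots> = \<delta>\<^sup>2 / 2 * real N * (\<delta> ^ 3 * (real N * sqrt (real N)))"
    by (simp add: q_def power2_eq_square numeral_eq_Suc)
  also have "\<dots> \<le> \<delta>\<^sup>2 / 2 * real N * (real (card D) ^ 3 * P ^ 3)"
    using cube by (intro mult_left_mono) auto
  finally have "(8 * \<eta>' * q) * P ^ 3 \<le> (\<delta>\<^sup>2 / 2 * real N * real (card D) ^ 3) * P ^ 3"
    by (simp add: mult_ac)
  then have "8 * \<eta>' * q \<le> \<delta>\<^sup>2 / 2 * real N * real (card D) ^ 3"
    by (rule mult_right_le_imp_le) (use P in simp)
  then have lower: "4 * \<eta>' * q \<le> real N * real (card (solutions D))"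
    using D(3) by (simp add: q_def mult.assoc)
  have "card (solutions D) \<le> 3 * (card A)\<^sup>2"
  proof (rule card_trivial_solutions_le[OF D(1)])
    fix x1 x2 x3 x4 x5
    assume "(x1, x4, x2, x3, x5) \<in> solutions D"
    then show "trivial_sol a b x1 x2 x3 x4 x5"
      using D(1) by (intro trivial) (auto simp: solutions_def)
  qed
  then have "real (card (solutions D)) \<le> real (3 * (card A)\<^sup>2)"
    by (simp only: of_nat_le_iff)
  also have "\<dots> \<le> 6 * real N"
    using card_A_squared_le by simp
  finally have "real N * real (card (solutions D)) \<le> real N * (6 * real N)"
    by (intro mult_left_mono) auto
  with lower have "(2 * \<eta>' * sqrt (real N)) * (2 * (real N)\<^sup>2) \<le> 3 * (2 * (real N)\<^sup>2)"
    by (simp add: q_def power2_eq_square mult_ac)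
  then have "2 * \<eta>' * sqrt (real N) \<le> 3"
    by (rule mult_right_le_imp_le) (use N_pos in simp)
  with large show False
    by simp
qed

end

text \<open>The quotient is the largest next threshold that \<open>energy_increment\<close> admits
  after \<open>threshold \<delta> M j\<close>, with \<open>M = 6 * (a + b)\<close>; the minimum
  keeps the sequence decreasing. Nothing here depends on \<open>n\<close>.\<close>

primrec threshold :: "real \<Rightarrow> real \<Rightarrow> nat \<Rightarrow> real" where
  "threshold \<delta> M 0 = \<delta>"
| "threshold \<delta> M (Suc j) =
    min (threshold \<delta> M j) (\<delta> ^ 5 / (16 * M ^ (3 * nat \<lceil>4 / threshold \<delta> M j ^ 4\<rceil>)))"

lemma threshold_pos: "\<delta> > 0 \<Longrightarrow> M > 0 \<Longrightarrow> threshold \<delta> M j > 0"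
  by (induction j) auto

lemma threshold_antimono: "i \<le> j \<Longrightarrow> threshold \<delta> M j \<le> threshold \<delta> M i"
  by (rule lift_Suc_antimono_le[where f = "threshold \<delta> M"]) auto

section \<open>Reduction to Sidon sets and the iteration over thresholds\<close>

lemma sidon_of_no_nontrivial_sol:
  assumes "a > 0" "no_nontrivial_sol a b A"
  shows "sidon (int ` A)"
  unfolding sidon_def
proof (intro ballI impI)
  fix x y z w assume "x \<in> int ` A" "y \<in> int ` A" "z \<in> int ` A" "w \<in> int ` A" and eq: "x + y = z + w"
  \<comment> \<open>With \<open>x3 = x5 = w\<close> the \<open>b\<close>-terms cancel. In the third
    trivial family \<open>x3 = x5\<close> makes all variables equal, so each family gives a Sidon
    alternative.\<close>
  moreover have "is_solution a b x y w z w"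
    using arg_cong[OF eq, of "(*) (int a)"] by (simp add: is_solution_def algebra_simps)
  ultimately have "trivial_sol a b x y w z w"
    using assms(2) unfolding no_nontrivial_sol_def by blast
  with eq show "(x = z \<and> y = w) \<or> (x = w \<and> y = z)"
    unfolding trivial_sol_def by auto
qed

theorem theorem1p16:
  fixes a b :: nat
  assumes "a > 0" and "b > 0"
  shows "\<forall>\<epsilon>::real. \<epsilon> > 0 \<longrightarrow> (\<exists>n0::nat. \<forall>n\<ge>n0. \<forall>A. A \<subseteq> {1..n} \<and> no_nontrivial_sol a b A
            \<longrightarrow> real (card A) \<le> \<epsilon> * sqrt (real n))"
proof (intro allI impI)
  fix \<epsilon> :: real assume "\<epsilon> > 0"
  \<comment> \<open>Normalised so that
    \<open>\<epsilon> * sqrt n = \<delta> * sqrt N\<close>.\<close>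
  define \<delta> where "\<delta> = \<epsilon> / sqrt (2 * (real a + real b))"
  define M where "M = 6 * (real a + real b)"
  \<comment> \<open>Each step gains more than \<open>\<delta>\<^sup>2 / 2 * N\<close> against the
    ceiling \<open>4 * N\<close>, so this many steps are impossible.\<close>
  define J where "J = nat \<lceil>8 / \<delta>\<^sup>2\<rceil>"
  define H where "H = threshold \<delta> M J"
  have \<delta>: "\<delta> > 0" and M: "M > 0"
    using assms \<open>\<epsilon> > 0\<close> by (auto simp: \<delta>_def M_def)
  have H: "H > 0"
    using \<delta> M by (simp add: H_def threshold_pos)
  have J: "4 \<le> real J * (\<delta>\<^sup>2 / 2)"
  proof -
    have "8 / \<delta>\<^sup>2 \<le> real J"
      unfolding J_def by linarith
    then show ?thesis
      using \<delta> by (simp add: field_simps)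
  qed
  \<comment> \<open>The first entry of the maximum serves \<open>energy_spec_le\<close> at the last
    threshold \<open>H\<close>, the second gives \<open>3 < 2 * H * sqrt N\<close>, and
    \<open>Suc\<close> makes \<open>n\<close> positive. As \<open>H\<close> is the smallest
    threshold in use, one \<open>n0\<close> covers every step.\<close>
  define n0 where "n0 = Suc (nat \<lceil>max (2 * M ^ (2 * nat \<lceil>4 / H ^ 4\<rceil>)) (4 / H\<^sup>2)\<rceil>)"
  show "\<exists>n0::nat. \<forall>n\<ge>n0. \<forall>A. A \<subseteq> {1..n} \<and> no_nontrivial_sol a b A
            \<longrightarrow> real (card A) \<le> \<epsilon> * sqrt (real n)"
  proof (intro exI allI impI, elim conjE, rule ccontr)
    fix n A
    assume "n0 \<le> n" and A: "A \<subseteq> {1..n}" "no_nontrivial_sol a b A"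
      and big: "\<not> real (card A) \<le> \<epsilon> * sqrt (real n)"
    define N where "N = 2 * (a + b) * n"
    have "n > 0"
      using \<open>n0 \<le> n\<close> by (simp add: n0_def)
    interpret sidon_instance a b n N "int ` A"
    proof
      show "int ` A \<subseteq> {1..int n}"
        using A(1) by auto
      show "sidon (int ` A)"
        using sidon_of_no_nontrivial_sol assms(1) A(2) by blast
    qed (use assms \<open>n > 0\<close> in \<open>auto simp: N_def\<close>)
    have "n \<le> N"
      using assms by (simp add: N_def)
    have "max (2 * M ^ (2 * nat \<lceil>4 / H ^ 4\<rceil>)) (4 / H\<^sup>2) \<le> real n"
      using \<open>n0 \<le> n\<close> unfolding n0_def by linarith
    also have "\<dots> \<le> real N"
      using \<open>n \<le> N\<close> by simp
    finally have N: "2 * M ^ (2 * nat \<lceil>4 / H ^ 4\<rceil>) \<le> real N" "4 / H\<^sup>2 \<le> real N"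
      by auto
    have "sqrt (4 / H\<^sup>2) \<le> sqrt (real N)"
      using N(2) by (rule real_sqrt_le_mono)
    then have "2 / H \<le> sqrt (real N)"
      using H by (simp add: real_sqrt_divide)
    then have HN: "3 < 2 * H * sqrt (real N)"
      using H by (simp add: field_simps)
    have card_A: "\<delta> * sqrt (real N) \<le> real (card (int ` A))"
    proof -
      have "\<delta> * sqrt (real N) = \<epsilon> * sqrt (real n)"
        using assms by (simp add: \<delta>_def N_def real_sqrt_mult)
      then show ?thesis
        using big by (simp add: card_image)
    qed
    have trivial: "trivial_sol a b x1 x2 x3 x4 x5"
      if "x1 \<in> int ` A" "x2 \<in> int ` A" "x3 \<in> int ` A" "x4 \<in> int ` A" "x5 \<in> int ` A"
        "is_solution a b x1 x2 x3 x4 x5" for x1 x2 x3 x4 x5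
      using that A(2) unfolding no_nontrivial_sol_def by blast
    define E where "E = (\<lambda>j. energy (spec (threshold \<delta> M j)))"
    have E_Suc: "E j + \<delta>\<^sup>2 / 2 * real N < E (Suc j)" if "j < J" for j
      unfolding E_def
    proof (rule energy_increment)
      let ?\<eta> = "threshold \<delta> M j" and ?\<eta>' = "threshold \<delta> M (Suc j)"
      show "0 < ?\<eta>" "0 < ?\<eta>'"
        using \<delta> M by (rule threshold_pos)+
      show "?\<eta> \<le> \<delta>" "?\<eta>' \<le> ?\<eta>"
        using threshold_antimono[of 0 j] by auto
      have "?\<eta>' \<le> \<delta> ^ 5 / (16 * M ^ (3 * nat \<lceil>4 / ?\<eta> ^ 4\<rceil>))"
        by simp
      then show "16 * ?\<eta>' * (6 * (real a + real b)) ^ (3 * nat \<lceil>4 / ?\<eta> ^ 4\<rceil>) \<le> \<delta> ^ 5"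
        using M unfolding M_def[symmetric] by (simp add: pos_le_divide_eq mult_ac del: threshold.simps)
      have "H \<le> ?\<eta>'"
        unfolding H_def using that by (intro threshold_antimono) auto
      then have "2 * H * sqrt (real N) \<le> 2 * ?\<eta>' * sqrt (real N)"
        by (intro mult_right_mono) auto
      with HN show "3 < 2 * ?\<eta>' * sqrt (real N)"
        by linarith
    qed (use card_A trivial in auto)
    have E_ge: "real j * (\<delta>\<^sup>2 / 2 * real N) \<le> E j" if "j \<le> J" for j
      using that
    proof (induction j)
      case 0
      then show ?case
        by (simp add: E_def energy_nonneg)
    next
      case (Suc j)
      then show ?case
        using E_Suc[of j] by (simp add: algebra_simps)
    qed
    \<comment> \<open>At least one step must be taken: its strict gain is what contradicts the
      ceiling, since \<open>J * (\<delta>\<^sup>2 / 2)\<close> may equal 4.\<close>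
    have "0 < J"
      using J by (intro gr0I) auto
    then have "real J * (\<delta>\<^sup>2 / 2 * real N) < E J"
      using E_ge[of "J - 1"] E_Suc[of "J - 1"] by (simp add: of_nat_diff algebra_simps)
    also have "E J \<le> 4 * real N"
      unfolding E_def using energy_spec_le[OF H] N(1) by (simp add: M_def H_def)
    also have "\<dots> \<le> real J * (\<delta>\<^sup>2 / 2) * real N"
      using J by (intro mult_right_mono) auto
    finally show False
      by (simp add: mult.assoc)
  qed
qed

end
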